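(* Let $x=[x_{ij}]\in\mathbb{R}^{n\times m}$, $y\in\mathbb{R}^n$, let $C^t=\{C_k^t\}_{k\in K^t}$ be a partition of $I=\{1,\dots,n\}$ into nonempty clusters, and let $\bar\beta^t\in\mathbb{R}^m$ be an optimal solution of the aggregated least absolute deviation problem $$F^t=\min_{\beta\in\mathbb{R}^m}\sum_{k\in K^t}|C_k^t|\,\Big|y_k^t-\sum_{j\in J}x_{kj}^t\beta_j\Big| .$$ If for every $k\in K^t$ the residuals $y_i-\sum_{j\in J}x_{ij}\bar\beta_j^t$, $i\in C_k^t$, all have the same sign (i.e. all entries of $C_k^t$ are on the same side of the hyperplane defined by $\bar\beta^t$), then $\bar\beta^t$ is an optimal solution of the original problem $$E^*=\min_{\beta\in\mathbb{R}^m}\sum_{i\in I}\Big|y_i-\sum_{j\in J}x_{ij}\beta_j\Big| .$$ Further, $E^t=F^t$, where $E^t=\sum_{i\in I}|y_i-\sum_{j\in J}x_{ij}\bar\beta_j^t|$.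
   Context: $I=\{1,\dots,n\}$ indexes entries (observations) and $J=\{1,\dots,m\}$ indexes attributes. Given the partition $C^t$ of $I$ with index set $K^t$, the aggregated data are the centroids $x_{kj}^t=\frac{1}{|C_k^t|}\sum_{i\in C_k^t}x_{ij}$ for $j\in J$ and $y_k^t=\frac{1}{|C_k^t|}\sum_{i\in C_k^t}y_i$, for $k\in K^t$. "All have the same sign" means: all residuals in the cluster are $>0$, or all are $\le 0$. *)

theory Defs
  imports "HOL-Analysis.Analysis"
begin

text \<open>
  Observations are indexed by the finite type \<open>'n\<close>, attributes by the finite type \<open>'m\<close>;
  \<open>x $ i $ j\<close> is the value of attribute \<open>j\<close> for observation \<open>i\<close>.
\<close>

definition is_clustering :: "'k set \<Rightarrow> ('k \<Rightarrow> 'i set) \<Rightarrow> bool" where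
  "is_clustering K C \<longleftrightarrow>
     (\<forall>k\<in>K. C k \<noteq> {}) \<and> disjoint_family_on C K \<and> (\<Union>k\<in>K. C k) = UNIV"

definition residual :: "real ^ 'm ^ 'n \<Rightarrow> real ^ 'n \<Rightarrow> real ^ 'm \<Rightarrow> 'n \<Rightarrow> real" where
  "residual x y \<beta> i = y $ i - (\<Sum>j\<in>UNIV. x $ i $ j * \<beta> $ j)"

definition lad_error :: "real ^ 'm ^ 'n \<Rightarrow> real ^ 'n \<Rightarrow> real ^ 'm \<Rightarrow> real" where
  "lad_error x y \<beta> = (\<Sum>i\<in>UNIV. \<bar>residual x y \<beta> i\<bar>)"

definition centroid_x :: "real ^ 'm ^ 'n \<Rightarrow> 'n set \<Rightarrow> 'm \<Rightarrow> real" where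
  "centroid_x x A j = 1 / real (card A) * (\<Sum>i\<in>A. x $ i $ j)"

definition centroid_y :: "real ^ 'n \<Rightarrow> 'n set \<Rightarrow> real" where
  "centroid_y y A = 1 / real (card A) * (\<Sum>i\<in>A. y $ i)"

definition agg_lad_error ::
  "'k set \<Rightarrow> ('k \<Rightarrow> 'n set) \<Rightarrow> real ^ 'm ^ 'n \<Rightarrow> real ^ 'n \<Rightarrow> real ^ 'm \<Rightarrow> real" where
  "agg_lad_error K C x y \<beta> =
     (\<Sum>k\<in>K. real (card (C k)) *
        \<bar>centroid_y y (C k) - (\<Sum>j\<in>UNIV. centroid_x x (C k) j * \<beta> $ j)\<bar>)"

definition optimal_solution :: "('b \<Rightarrow> real) \<Rightarrow> 'b \<Rightarrow> bool" where
  "optimal_solution f \<beta> \<longleftrightarrow> is_arg_min f (\<lambda>_. True) \<beta>"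

text \<open>
  The optimal value is an infimum, which is the minimum whenever an optimal solution exists.
  The infimum of real numbers is meaningful only for objectives bounded below; the
  objectives above are nonnegative.
\<close>

definition optimal_value :: "('b \<Rightarrow> real) \<Rightarrow> real" where
  "optimal_value f = (INF \<beta>. f \<beta>)"

text \<open>A zero residual counts as being on the nonpositive side.\<close>

definition same_sign_on :: "'i set \<Rightarrow> ('i \<Rightarrow> real) \<Rightarrow> bool" where
  "same_sign_on A r \<longleftrightarrow> (\<forall>i\<in>A. r i > 0) \<or> (\<forall>i\<in>A. r i \<le> 0)"

end

theory Submission
  imports Defs
begin

text \<open>
  By linearity, a cluster contributes the absolute value of the sum of its residuals to the
  aggregated objective. Hence the triangle inequality makes the aggregated objective a lower bound
  of the original one, with equality at every \<open>\<beta>\<close> whose residuals have constant sign on each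
  cluster. A minimizer of the lower bound at which the two objectives agree minimizes both.
\<close>

text \<open>Nonempty disjoint clusters are pairwise distinct, so \<open>C\<close> embeds
  \<open>K\<close> into the finite power set of the observations. Sums over \<open>K\<close> are
  therefore genuine finite sums.\<close>

lemma clustering_finite:
  fixes C :: "'k \<Rightarrow> 'n::finite set"
  assumes "is_clustering K C"
  shows "finite K"
proof -
  have "inj_on C K"
    using assms unfolding is_clustering_def inj_on_def disjoint_family_on_def by (metis Int_absorb)
  then show ?thesis
    using finite_imageD[of C K] by simp
qed

lemma sum_clustering:
  fixes C :: "'k \<Rightarrow> 'n::finite set"
  assumes "is_clustering K C"
  shows "(\<Sum>i\<in>UNIV. f i) = (\<Sum>k\<in>K. \<Sum>i\<in>C k. f i)"
proof -
  have "(\<Sum>i\<in>(\<Union>k\<in>K. C k). f i) = (\<Sum>k\<in>K. \<Sum>i\<in>C k. f i)"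
    using assms clustering_finite[OF assms]
    by (intro sum.UNION_disjoint) (auto simp: is_clustering_def disjoint_family_on_def)
  then show ?thesis
    using assms by (simp add: is_clustering_def)
qed

text \<open>The weight \<open>card A\<close> cancels the denominators of both centroids;
  nonemptiness makes it positive, so it can be moved inside the absolute value.\<close>

lemma card_times_abs_centroid_residual:
  fixes x :: "real ^ 'm ^ 'n" and A :: "'n set"
  assumes "A \<noteq> {}"
  shows "real (card A) * \<bar>centroid_y y A - (\<Sum>j\<in>UNIV. centroid_x x A j * \<beta> $ j)\<bar>
    = \<bar>\<Sum>i\<in>A. residual x y \<beta> i\<bar>"
proof -
  have card: "real (card A) > 0"
    using assms by (simp add: card_gt_0_iff)
  have "(\<Sum>j\<in>UNIV. (\<Sum>i\<in>A. x $ i $ j) * \<beta> $ j) = (\<Sum>i\<in>A. \<Sum>j\<in>UNIV. x $ i $ j * \<beta> $ j)"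
    unfolding sum_distrib_right by (rule sum.swap)
  then have "real (card A) * (centroid_y y A - (\<Sum>j\<in>UNIV. centroid_x x A j * \<beta> $ j))
    = (\<Sum>i\<in>A. residual x y \<beta> i)"
    using card
    by (simp add: centroid_y_def centroid_x_def residual_def sum_subtractf right_diff_distrib
        flip: sum_divide_distrib)
  then show ?thesis
    using card by (metis abs_mult abs_of_pos)
qed

lemma agg_lad_error_eq:
  assumes "is_clustering K C"
  shows "agg_lad_error K C x y \<beta> = (\<Sum>k\<in>K. \<bar>\<Sum>i\<in>C k. residual x y \<beta> i\<bar>)"
  unfolding agg_lad_error_def
  using assms by (intro sum.cong card_times_abs_centroid_residual) (auto simp: is_clustering_def)

lemma agg_lad_error_le_lad_error:
  assumes "is_clustering K C"
  shows "agg_lad_error K C x y \<beta> \<le> lad_error x y \<beta>"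
  unfolding agg_lad_error_eq[OF assms] lad_error_def sum_clustering[OF assms]
  by (intro sum_mono sum_abs)

text \<open>Terms of constant sign cannot cancel: this is the equality case of the triangle
  inequality.\<close>

lemma abs_sum_same_sign:
  fixes r :: "'i \<Rightarrow> real"
  assumes "same_sign_on A r"
  shows "\<bar>\<Sum>i\<in>A. r i\<bar> = (\<Sum>i\<in>A. \<bar>r i\<bar>)"
  using assms unfolding same_sign_on_def
proof
  assume "\<forall>i\<in>A. r i > 0"
  then show ?thesis
    by (simp add: sum_nonneg less_imp_le)
next
  assume "\<forall>i\<in>A. r i \<le> 0"
  then show ?thesis
    by (simp add: sum_nonpos abs_of_nonpos sum_negf)
qed

lemma lad_error_eq_agg_lad_error:
  assumes "is_clustering K C"
    and "\<forall>k\<in>K. same_sign_on (C k) (residual x y \<beta>)"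
  shows "lad_error x y \<beta> = agg_lad_error K C x y \<beta>"
  unfolding agg_lad_error_eq[OF assms(1)] lad_error_def sum_clustering[OF assms(1)]
  using assms(2) by (simp add: abs_sum_same_sign)

lemma optimal_solution_iff: "optimal_solution f \<beta> \<longleftrightarrow> (\<forall>\<gamma>. f \<beta> \<le> f \<gamma>)"
  by (auto simp: optimal_solution_def is_arg_min_linorder)

text \<open>The value at a minimizer is itself a lower bound that is attained, so the infimum is
  meaningful here without a separate boundedness argument.\<close>

lemma optimal_value_eq:
  assumes "optimal_solution f \<beta>"
  shows "optimal_value f = f \<beta>"
  unfolding optimal_value_def
  using assms by (intro cInf_eq_minimum) (auto simp: optimal_solution_iff)

theorem proposition1:
  fixes x :: "real ^ 'm ^ 'n" and y :: "real ^ 'n"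
    and K :: "'k set" and C :: "'k \<Rightarrow> 'n set"
    and \<beta>t :: "real ^ 'm"
  assumes "is_clustering K C"
    and "optimal_solution (agg_lad_error K C x y) \<beta>t"
    and "\<forall>k\<in>K. same_sign_on (C k) (residual x y \<beta>t)"
  shows "optimal_solution (lad_error x y) \<beta>t \<and>
    lad_error x y \<beta>t = optimal_value (agg_lad_error K C x y)"
proof
  note eq = lad_error_eq_agg_lad_error[OF assms(1,3)]
  show "optimal_solution (lad_error x y) \<beta>t"
    \<comment> \<open>\<open>eq\<close> rewrites the error at \<open>\<beta>t\<close> only. What
      remains follows by passing through the aggregated error of the competitor: optimality of
      \<open>\<beta>t\<close> gives the first inequality, the lower bound the second.\<close>
    unfolding optimal_solution_iff eq
    using assms(2) agg_lad_error_le_lad_error[OF assms(1)]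
    by (meson optimal_solution_iff order_trans)
  show "lad_error x y \<beta>t = optimal_value (agg_lad_error K C x y)"
    using eq optimal_value_eq[OF assms(2)] by simp
qed

end
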